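(* Let $\mathcal H$ be a separable Hilbert space, let $\mathbf J\in\mathcal B(\mathcal H)$ be skew-adjoint and let $\mathbf R\in\mathcal B(\mathcal H)$ be self-adjoint with $\mathbf R\ge0$. If $$\operatorname{span}\Big(\bigcup_{j=0}^\infty\operatorname{im}\big(\mathbf J^j\sqrt{\mathbf R}\big)\Big)=\mathcal H,$$ then there exists $m\in\mathbb N_0$ such that $$\operatorname{span}\Big(\bigcup_{j=0}^m\operatorname{im}\big(\mathbf J^j\sqrt{\mathbf R}\big)\Big)=\mathcal H.$$
   Context: $\mathcal B(\mathcal H)$ is the space of bounded linear operators on $\mathcal H$; $\operatorname{span}$ denotes the algebraic linear span (finite linear combinations, no closure); $\sqrt{\mathbf R}$ is the unique nonnegative self-adjoint square root of $\mathbf R$. Skew-adjoint means $\mathbf J^*=-\mathbf J$. *)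

theory Defs
  imports "HOL-Analysis.Analysis"
begin

text \<open>
  The scalars are the reals or the complex numbers. Both are instances of the following class, and
  \<open>conj_scalar_cases\<close> below shows that it has no other instances up to isomorphism:
  a field in the class is either spanned over the reals by 1, or by 1 and a square root of -1.
\<close>

class conj_scalar = real_normed_field +
  fixes conj :: "'a \<Rightarrow> 'a"
  assumes conj_add: "conj (x + y) = conj x + conj y"
    and conj_mult: "conj (x * y) = conj x * conj y"
    and mult_conj_self_scaleR: "x * conj x = (norm x)\<^sup>2 *\<^sub>R 1"

instantiation real :: conj_scalar
begin
definition conj_real :: "real \<Rightarrow> real" where "conj_real x = x"
instance by standard (auto simp: conj_real_def power2_eq_square)
end

instantiation complex :: conj_scalar
begin
definition conj_complex :: "complex \<Rightarrow> complex" where "conj_complex = cnj"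
instance by standard (auto simp: conj_complex_def complex_norm_square[symmetric] scaleR_conv_of_real)
end

lemma mult_conj_self: "x * conj x = of_real ((norm (x :: 'k::conj_scalar))\<^sup>2)"
  by (simp add: mult_conj_self_scaleR of_real_def)

lemma conj_1: "conj (1 :: 'k::conj_scalar) = 1"
  using mult_conj_self[of "1 :: 'k"] by simp

lemma add_conj_self:
  fixes x :: "'k::conj_scalar"
  shows "x + conj x = of_real ((norm (1 + x))\<^sup>2 - 1 - (norm x)\<^sup>2)"
proof -
  have "of_real ((norm (1 + x))\<^sup>2) = (1 + x) * conj (1 + x)"
    by (rule mult_conj_self[symmetric])
  also have "\<dots> = 1 + (x + conj x) + x * conj x"
    by (simp add: conj_add conj_1 algebra_simps)
  also have "\<dots> = 1 + (x + conj x) + of_real ((norm x)\<^sup>2)"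
    by (simp only: mult_conj_self)
  finally show ?thesis by (simp add: algebra_simps)
qed

lemma conj_scalar_quadratic:
  fixes x :: "'k::conj_scalar"
  obtains a b :: real where "b \<ge> 0" "(x - of_real a)\<^sup>2 = - of_real (b\<^sup>2)"
proof -
  obtain s :: real where s: "x + conj x = of_real s" using add_conj_self by blast
  define a where "a = s / 2"
  have cx: "conj x = 2 * of_real a - x" using s by (simp add: a_def algebra_simps)
  have sq: "(x - of_real a)\<^sup>2 = of_real (a\<^sup>2 - (norm x)\<^sup>2)"
    using mult_conj_self[of x] unfolding cx
    by (simp add: power2_eq_square algebra_simps)
  have "2 * \<bar>a\<bar> = norm (of_real s :: 'k)" by (simp add: a_def)
  also have "\<dots> \<le> norm x + norm (conj x)" unfolding s[symmetric] by (rule norm_triangle_ineq)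
  also have "norm (conj x) = norm x"
  proof (cases "x = 0")
    case True
    then show ?thesis using conj_add[of 0 "0::'k"] by simp
  next
    case False
    have "norm x * norm (conj x) = norm x * norm x"
      using arg_cong[OF mult_conj_self[of x], of norm] by (simp add: norm_mult power2_eq_square)
    with False show ?thesis by simp
  qed
  finally have "\<bar>a\<bar> \<le> norm x" by simp
  then have "0 \<le> (norm x)\<^sup>2 - a\<^sup>2" using abs_le_square_iff[of a "norm x"] by simp
  then have "(sqrt ((norm x)\<^sup>2 - a\<^sup>2))\<^sup>2 = (norm x)\<^sup>2 - a\<^sup>2" by simp
  then show thesis using that[of "sqrt ((norm x)\<^sup>2 - a\<^sup>2)" a] sq \<open>0 \<le> (norm x)\<^sup>2 - a\<^sup>2\<close>
    by (metis minus_diff_eq of_real_minus real_sqrt_ge_0_iff)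
qed

lemma conj_scalar_cases:
  "(\<forall>x::'k::conj_scalar. x \<in> \<real>) \<or>
   (\<exists>i::'k. i\<^sup>2 = -1 \<and> (\<forall>x. \<exists>a b. x = of_real a + of_real b * i))"
proof (cases "\<forall>x::'k. x \<in> \<real>")
  case False
  then obtain z :: 'k where z: "z \<notin> \<real>" by blast
  obtain a b :: real where ab: "b \<ge> 0" "(z - of_real a)\<^sup>2 = - of_real (b\<^sup>2)"
    using conj_scalar_quadratic .
  have "b \<noteq> 0"
  proof
    assume "b = 0"
    then have "z = of_real a" using ab by simp
    then show False using z by simp
  qed
  define i where "i = (z - of_real a) / of_real b"
  have i: "i\<^sup>2 = -1" using ab \<open>b \<noteq> 0\<close> by (simp add: i_def power_divide)
  have "\<exists>a b. x = of_real a + of_real b * i" for x :: 'k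
  proof -
    obtain c d :: real where cd: "d \<ge> 0" "(x - of_real c)\<^sup>2 = - of_real (d\<^sup>2)"
      using conj_scalar_quadratic .
    then have "(x - of_real c)\<^sup>2 = (of_real d * i)\<^sup>2" using i by (simp add: power_mult_distrib)
    then have "x - of_real c = of_real d * i \<or> x - of_real c = - (of_real d * i)"
      by (simp only: power2_eq_iff)
    then have "x = of_real c + of_real d * i \<or> x = of_real c + of_real (- d) * i"
      by (auto simp: algebra_simps)
    then show ?thesis by blast
  qed
  with i show ?thesis by blast
qed simp

text \<open>
  A Hilbert space over \<open>'k\<close>: completeness is part of the class \<open>banach\<close>, and the last axiom says that
  the norm of the type is the one induced by the inner product.
\<close>

locale hilbert_space = vector_space smul
  for smul :: "'k::conj_scalar \<Rightarrow> 'h::banach \<Rightarrow> 'h" +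
  fixes ip :: "'h \<Rightarrow> 'h \<Rightarrow> 'k"
  assumes scale_of_real: "smul (of_real r) x = r *\<^sub>R x"
    and ip_add_left: "ip (x + y) z = ip x z + ip y z"
    and ip_scale_left: "ip (smul c x) z = c * ip x z"
    and ip_conj: "ip y x = conj (ip x y)"
    and ip_self: "ip x x = of_real ((norm x)\<^sup>2)"

text \<open>
  The type \<open>'h \<Rightarrow>\<^sub>L 'h\<close> consists of the bounded real-linear maps, so over the complex numbers
  linearity with respect to \<open>smul\<close> has to be required in addition.
\<close>

definition bounded_operators :: "('k::field \<Rightarrow> 'h::real_normed_vector \<Rightarrow> 'h) \<Rightarrow> ('h \<Rightarrow>\<^sub>L 'h) set" where
  "bounded_operators smul = {T. Vector_Spaces.linear smul smul (blinfun_apply T)}"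

definition is_adjoint ::
    "('h::real_normed_vector \<Rightarrow> 'h \<Rightarrow> 'k) \<Rightarrow> ('h \<Rightarrow>\<^sub>L 'h) \<Rightarrow> ('h \<Rightarrow>\<^sub>L 'h) \<Rightarrow> bool" where
  "is_adjoint ip T T' \<longleftrightarrow> (\<forall>x y. ip (T x) y = ip x (T' y))"

lemma (in hilbert_space) is_adjoint_unique:
  assumes "is_adjoint ip T T'" "is_adjoint ip T T''"
  shows "T' = T''"
proof (rule blinfun_eqI)
  fix y
  have diff: "ip (v - w) u = ip v u - ip w u" for u v w
    using ip_add_left[of "v - w" w u] by simp
  have "ip (T' y - T'' y) x = 0" for x
  proof -
    have "ip x (T' y) = ip x (T'' y)" using assms by (simp add: is_adjoint_def)
    then have "conj (ip x (T' y)) = conj (ip x (T'' y))" by simp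
    then show ?thesis by (simp add: diff ip_conj[symmetric])
  qed
  from this[of "T' y - T'' y"] show "T' y = T'' y" by (simp add: ip_self)
qed

definition self_adjoint :: "('h::real_normed_vector \<Rightarrow> 'h \<Rightarrow> 'k) \<Rightarrow> ('h \<Rightarrow>\<^sub>L 'h) \<Rightarrow> bool" where
  "self_adjoint ip T \<longleftrightarrow> is_adjoint ip T T"

definition skew_adjoint :: "('h::real_normed_vector \<Rightarrow> 'h \<Rightarrow> 'k) \<Rightarrow> ('h \<Rightarrow>\<^sub>L 'h) \<Rightarrow> bool" where
  "skew_adjoint ip T \<longleftrightarrow> is_adjoint ip T (- T)"

definition nonneg_op ::
    "('h::real_normed_vector \<Rightarrow> 'h \<Rightarrow> 'k::real_algebra_1) \<Rightarrow> ('h \<Rightarrow>\<^sub>L 'h) \<Rightarrow> bool" where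
  "nonneg_op ip T \<longleftrightarrow> (\<forall>x. ip (T x) x \<in> \<real>\<^sub>\<ge>\<^sub>0)"

definition op_sqrt ::
    "('k::real_normed_field \<Rightarrow> 'h::real_normed_vector \<Rightarrow> 'h) \<Rightarrow> ('h \<Rightarrow> 'h \<Rightarrow> 'k) \<Rightarrow>
     ('h \<Rightarrow>\<^sub>L 'h) \<Rightarrow> ('h \<Rightarrow>\<^sub>L 'h)" where
  "op_sqrt smul ip R =
     (THE S. S \<in> bounded_operators smul \<and> self_adjoint ip S \<and> nonneg_op ip S \<and> S o\<^sub>L S = R)"

end

theory Submission imports Defs begin

text \<open>
  Put \<open>A\<^sub>j = J\<^sup>j \<surd>R\<close>, a bounded operator, and let \<open>V\<^sub>m\<close> be the span of the ranges of
  \<open>A\<^sub>0, \<dots>, A\<^sub>m\<close>. An element of the span of all the ranges is a linear combination of finitely many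
  vectors, so \<open>\<H>\<close> is the union of the increasing sequence of subspaces \<open>V\<^sub>m\<close>. The spaces
  \<open>V\<^sub>m\<close> need not be closed, so Baire's theorem does not apply to them directly. But each is the
  range of a bounded operator on a Banach space, namely of
  \<open>(x\<^sub>0, \<dots>, x\<^sub>m) \<mapsto> A\<^sub>0 x\<^sub>0 + \<dots> + A\<^sub>m x\<^sub>m\<close> on \<open>\<H>\<^sup>m\<^sup>+\<^sup>1\<close>, and so it is the countable union of the images
  of the balls of integer radius. By Baire's theorem the closure of one of these countably many
  images has an interior point. As in the open mapping theorem, this makes every vector
  approximable, to within half of its norm, by the image of a tuple of comparable norm
  (\<open>interior_closure_imp_approximation\<close>), and iterating the approximation on the error writes the
  vector as such an image exactly (\<open>approximation_imp_onto\<close>). Hence \<open>V\<^sub>m = \<H>\<close> for that \<open>m\<close>.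

  The Banach space argument is carried out over the reals, for an arbitrary sequence of bounded
  real-linear maps (\<open>finitely_many_ranges_suffice\<close>). To transfer it to the field of scalars \<open>K\<close>,
  write \<open>K = \<real> + \<real>i\<close> (with \<open>i = 0\<close> if \<open>K = \<real>\<close>): the \<open>K\<close>-span of the range of a real-linear
  map \<open>A\<close> is the range of the real-linear map \<open>(x, y) \<mapsto> A x + i A y\<close>. The operators \<open>J\<close> and
  \<open>\<surd>R\<close> enter through their type, whose elements are bounded and real-linear.
\<close>

section \<open>Sums of ranges in Banach spaces\<close>

text \<open>
  The successive approximation of the open mapping theorem. The errors decrease geometrically, and
  so do the corrections: their sums converge by completeness of the domain and give an exact solution.
\<close>

lemma approximation_imp_onto:
  fixes T :: "'i \<Rightarrow> 'a::banach \<Rightarrow> 'b::real_normed_vector"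
  assumes T: "\<And>i. i \<in> I \<Longrightarrow> bounded_linear (T i)"
    and approx: "\<And>y. \<exists>x. (\<forall>i\<in>I. norm (x i) \<le> C * norm y) \<and>
                          norm (y - (\<Sum>i\<in>I. T i (x i))) \<le> norm y / 2"
  shows "\<exists>x. y = (\<Sum>i\<in>I. T i (x i))"
proof -
  obtain f where f: "\<And>y i. i \<in> I \<Longrightarrow> norm (f y i) \<le> C * norm y"
      "\<And>y. norm (y - (\<Sum>i\<in>I. T i (f y i))) \<le> norm y / 2"
    using approx by metis
  define e where "e n = ((\<lambda>z. z - (\<Sum>i\<in>I. T i (f z i))) ^^ n) y" for n
  have e0: "e 0 = y" and eSuc: "e (Suc n) = e n - (\<Sum>i\<in>I. T i (f (e n) i))" for n
    by (simp_all add: e_def)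
  have e_le: "norm (e n) \<le> norm y * (1/2) ^ n" for n
  proof (induction n)
    case (Suc n)
    have "norm (e (Suc n)) \<le> norm (e n) / 2" by (simp only: eSuc f(2))
    with Suc show ?case by simp
  qed (simp add: e0)
  have e_lim: "e \<longlonglongrightarrow> 0"
  proof (rule Lim_null_comparison)
    show "\<forall>\<^sub>F n in sequentially. norm (e n) \<le> norm y * (1/2) ^ n" using e_le by simp
    show "(\<lambda>n. norm y * (1/2) ^ n) \<longlonglongrightarrow> 0"
      by (intro tendsto_mult_right_zero LIMSEQ_power_zero) simp
  qed
  have summable: "summable (\<lambda>n. f (e n) i)" if "i \<in> I" for i
  proof (rule summable_comparison_test')
    show "summable (\<lambda>n. \<bar>C\<bar> * (norm y * (1/2) ^ n))"
      by (intro summable_mult summable_geometric) simp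
    fix n
    have "norm (f (e n) i) \<le> C * norm (e n)" by (rule f(1)[OF that])
    also have "\<dots> \<le> \<bar>C\<bar> * norm (e n)" by (intro mult_right_mono) auto
    also have "\<dots> \<le> \<bar>C\<bar> * (norm y * (1/2) ^ n)" by (intro mult_left_mono e_le) auto
    finally show "norm (f (e n) i) \<le> \<bar>C\<bar> * (norm y * (1/2) ^ n)" .
  qed
  have "(\<lambda>n. \<Sum>i\<in>I. T i (f (e n) i)) sums (\<Sum>i\<in>I. T i (\<Sum>n. f (e n) i))"
    by (intro sums_sum bounded_linear.sums[OF T] summable_sums summable)
  moreover have "(\<lambda>n. \<Sum>i\<in>I. T i (f (e n) i)) sums y"
    using telescope_sums'[OF e_lim] by (simp add: eSuc e0)
  ultimately have "y = (\<Sum>i\<in>I. T i (\<Sum>n. f (e n) i))" by (rule sums_unique2[symmetric])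
  then show ?thesis by (rule exI[of _ "\<lambda>i. \<Sum>n. f (e n) i"])
qed

text \<open>
  Let \<open>a\<close> be the centre of a ball in the closure. A short vector \<open>z\<close> is the difference of the two points
  \<open>a + z\<close> and \<open>a\<close> of the ball, so a difference of two tuples approximates it; by homogeneity the
  estimate extends to all vectors.
\<close>

lemma interior_closure_imp_approximation:
  fixes T :: "'i \<Rightarrow> 'a::real_normed_vector \<Rightarrow> 'b::real_normed_vector"
  assumes T: "\<And>i. i \<in> I \<Longrightarrow> linear (T i)"
    and interior: "interior (closure {\<Sum>i\<in>I. T i (x i) | x. \<forall>i\<in>I. norm (x i) \<le> N}) \<noteq> {}"
  obtains C where "\<And>y. \<exists>x. (\<forall>i\<in>I. norm (x i) \<le> C * norm y) \<and>
                            norm (y - (\<Sum>i\<in>I. T i (x i))) \<le> norm y / 2"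
proof -
  let ?S = "{\<Sum>i\<in>I. T i (x i) | x. \<forall>i\<in>I. norm (x i) \<le> N}"
  obtain a r where r: "r > 0" and ball: "ball a r \<subseteq> closure ?S"
    using interior by (meson equals0I mem_interior)
  have near: "\<exists>x. (\<forall>i\<in>I. norm (x i) \<le> N) \<and> norm (b - (\<Sum>i\<in>I. T i (x i))) < r / 8"
    if "b \<in> ball a r" for b
  proof -
    from that ball have "b \<in> closure ?S" by blast
    moreover have "r / 8 > 0" using r by simp
    ultimately obtain w where "w \<in> ?S" "dist w b < r / 8"
      unfolding closure_approachable by blast
    then show ?thesis by (auto simp: dist_norm norm_minus_commute)
  qed
  have "\<exists>x. (\<forall>i\<in>I. norm (x i) \<le> 4 * N / r * norm y) \<and>
            norm (y - (\<Sum>i\<in>I. T i (x i))) \<le> norm y / 2" for y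
  proof (cases "y = 0")
    case True
    then show ?thesis using T by (intro exI[of _ "\<lambda>_. 0"]) (simp add: linear_0)
  next
    case False
    \<comment> \<open>The multiple \<open>s y\<close> has norm \<open>r / 2\<close>.\<close>
    define s where "s = r / (2 * norm y)"
    have s: "s > 0" using r False by (simp add: s_def)
    have "a \<in> ball a r" "a + s *\<^sub>R y \<in> ball a r"
      using r False by (auto simp: dist_norm s_def)
    then obtain u v where u: "\<forall>i\<in>I. norm (u i) \<le> N" "norm (a - (\<Sum>i\<in>I. T i (u i))) < r / 8"
      and v: "\<forall>i\<in>I. norm (v i) \<le> N" "norm (a + s *\<^sub>R y - (\<Sum>i\<in>I. T i (v i))) < r / 8"
      using near by meson
    define x where "x i = (v i - u i) /\<^sub>R s" for i
    have sum_x: "(\<Sum>i\<in>I. T i (x i)) = ((\<Sum>i\<in>I. T i (v i)) - (\<Sum>i\<in>I. T i (u i))) /\<^sub>R s"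
    proof -
      have "(\<Sum>i\<in>I. T i (x i)) = (\<Sum>i\<in>I. (T i (v i) - T i (u i)) /\<^sub>R s)"
        using T by (intro sum.cong) (simp_all add: x_def linear_scale linear_diff)
      then show ?thesis by (simp add: scaleR_sum_right[symmetric] sum_subtractf)
    qed
    have "y - (\<Sum>i\<in>I. T i (x i)) =
        ((a + s *\<^sub>R y - (\<Sum>i\<in>I. T i (v i))) - (a - (\<Sum>i\<in>I. T i (u i)))) /\<^sub>R s"
      using s by (simp add: sum_x algebra_simps)
    then have "norm (y - (\<Sum>i\<in>I. T i (x i))) =
        norm ((a + s *\<^sub>R y - (\<Sum>i\<in>I. T i (v i))) - (a - (\<Sum>i\<in>I. T i (u i)))) / s"
      using s by (simp add: divide_inverse mult.commute)
    also have "\<dots> \<le> (r / 8 + r / 8) / s"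
      using u(2) v(2) s by (intro divide_right_mono order.trans[OF norm_triangle_ineq4]) auto
    also have "\<dots> = norm y / 2" using r by (simp add: s_def)
    finally have "norm (y - (\<Sum>i\<in>I. T i (x i))) \<le> norm y / 2" .
    moreover have "norm (x i) \<le> 4 * N / r * norm y" if "i \<in> I" for i
    proof -
      have "norm (x i) = norm (v i - u i) / s"
        using s by (simp add: x_def divide_inverse mult.commute)
      also have "\<dots> \<le> (N + N) / s"
        using u(1) v(1) s that
        by (intro divide_right_mono order.trans[OF norm_triangle_ineq4] add_mono) auto
      also have "\<dots> = 4 * N / r * norm y" using r False by (simp add: s_def)
      finally show ?thesis .
    qed
    ultimately show ?thesis by blast
  qed
  then show thesis by (rule that)
qed

lemma Baire_union:
  fixes F :: "'i::countable \<Rightarrow> 'a::{complete_space} set"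
  assumes "(\<Union>i. F i) = UNIV"
  obtains i where "interior (closure (F i)) \<noteq> {}"
proof -
  have "\<exists>i. interior (closure (F i)) \<noteq> {}"
  proof (rule ccontr)
    assume "\<not> ?thesis"
    then have "Met_TC.mtopology interior_of \<Union>(range (\<lambda>i. closure (F i))) = {}"
      by (intro Met_TC.metric_Baire_category_alt) (auto simp: complete_UNIV)
    moreover have "\<Union>(range (\<lambda>i. closure (F i))) = UNIV"
    proof -
      have "F i \<subseteq> closure (F i)" for i by (rule closure_subset)
      with assms show ?thesis by blast
    qed
    ultimately show False by simp
  qed
  then show thesis using that by blast
qed

text \<open>
  For each \<open>m\<close> the sums form a subspace. If only its closure were known to have interior, it could
  still be a proper dense subspace. Splitting it further, according to a bound \<open>n\<close> on the arguments,
  gives images of balls, and an interior point in the closure of such an image does suffice, by the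
  open mapping argument.
\<close>

lemma finitely_many_ranges_suffice:
  fixes T :: "nat \<Rightarrow> 'a::banach \<Rightarrow> 'b::banach"
  assumes T: "\<And>j. bounded_linear (T j)"
    and cover: "\<And>y. \<exists>m x. y = (\<Sum>j\<le>m. T j (x j))"
  obtains m where "\<And>y. \<exists>x. y = (\<Sum>j\<le>m. T j (x j))"
proof -
  define F where "F = (\<lambda>(m, n). {\<Sum>j\<in>{..m}. T j (x j) | x. \<forall>j\<in>{..m}. norm (x j) \<le> real n})"
  have "y \<in> (\<Union>p. F p)" for y
  proof -
    obtain m x where y: "y = (\<Sum>j\<le>m. T j (x j))" using cover by blast
    obtain n where "(\<Sum>j\<le>m. norm (x j)) \<le> real n" using real_arch_simple by blast
    then have "norm (x j) \<le> real n" if "j \<le> m" for j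
      using that member_le_sum[of j "{..m}" "\<lambda>j. norm (x j)"] by simp
    then have "y \<in> F (m, n)" unfolding F_def using y by auto
    then show ?thesis by blast
  qed
  then have "(\<Union>p. F p) = UNIV" by blast
  then obtain p where "interior (closure (F p)) \<noteq> {}" by (rule Baire_union)
  moreover obtain m n where "p = (m, n)" by (cases p)
  ultimately have "interior (closure {\<Sum>j\<in>{..m}. T j (x j) | x. \<forall>j\<in>{..m}. norm (x j) \<le> real n}) \<noteq> {}"
    by (simp add: F_def)
  then obtain C where "\<And>y. \<exists>x. (\<forall>j\<in>{..m}. norm (x j) \<le> C * norm y) \<and>
      norm (y - (\<Sum>j\<le>m. T j (x j))) \<le> norm y / 2"
    using interior_closure_imp_approximation[of "{..m}" T "real n"] T bounded_linear.linear by blast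
  then have "\<exists>x. y = (\<Sum>j\<le>m. T j (x j))" for y
    using approximation_imp_onto[of "{..m}" T C y] T by blast
  then show thesis by (rule that)
qed

section \<open>Passage from real scalars to the field of the Hilbert space\<close>

lemma conj_scalar_generated_by_one_element:
  obtains i :: "'k::conj_scalar" where "\<And>c. \<exists>a b. c = of_real a + of_real b * i"
  using conj_scalar_cases[where 'k = 'k]
proof
  assume "\<forall>x::'k. x \<in> \<real>"
  then have "\<exists>a b. c = of_real a + of_real b * (0 :: 'k)" for c by (auto elim: Reals_cases)
  then show thesis by (rule that)
qed (use that in blast)

context hilbert_space
begin

lemma norm_smul: "norm (smul c x) = norm c * norm x"
proof -
  have "of_real ((norm (smul c x))\<^sup>2) = ip (smul c x) (smul c x)" by (rule ip_self[symmetric])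
  also have "\<dots> = c * ip x (smul c x)" by (rule ip_scale_left)
  also have "ip x (smul c x) = conj (c * ip x x)" by (metis ip_conj ip_scale_left)
  also have "\<dots> = conj c * ip x x" by (metis conj_mult ip_conj)
  also have "c * (conj c * ip x x) = of_real ((norm c * norm x)\<^sup>2)"
    by (simp add: mult.assoc[symmetric] mult_conj_self ip_self power_mult_distrib)
  finally have "(norm (smul c x))\<^sup>2 = (norm c * norm x)\<^sup>2" by (simp only: of_real_eq_iff)
  then show ?thesis by (simp add: power2_eq_iff_nonneg)
qed

lemma bounded_linear_smul: "bounded_linear (smul c)"
proof (rule bounded_linear_intro)
  show "smul c (x + y) = smul c x + smul c y" for x y by (rule scale_right_distrib)
  show "smul c (r *\<^sub>R x) = r *\<^sub>R smul c x" for r x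
    by (simp add: scale_of_real[symmetric] mult.commute)
  show "norm (smul c x) \<le> norm x * norm c" for x by (simp add: norm_smul mult.commute)
qed

text \<open>
  The sums on the right are closed under scalar multiplication because \<open>c\<close> and \<open>c i\<close> are both real
  combinations of 1 and \<open>i\<close>.
\<close>

lemma span_ranges_subset:
  assumes i: "\<And>c. \<exists>a b. c = of_real a + of_real b * i"
    and A: "\<And>j. linear (A j)"
    and "finite I"
  shows "span (\<Union>j\<in>I. range (A j)) \<subseteq> {\<Sum>j\<in>I. A j (x j) + smul i (A j (y j)) | x y. True}"
    (is "_ \<subseteq> ?E")
proof (rule span_minimal)
  interpret smul: bounded_linear "smul i" by (rule bounded_linear_smul)
  have E: "(\<Sum>j\<in>I. A j (x j) + smul i (A j (y j))) \<in> ?E" for x y by blast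
  show "(\<Union>j\<in>I. range (A j)) \<subseteq> ?E"
  proof
    fix z assume "z \<in> (\<Union>j\<in>I. range (A j))"
    then obtain j u where ju: "j \<in> I" "z = A j u" by blast
    have "(\<Sum>l\<in>I. A l (if l = j then u else 0) + smul i (A l 0)) = (\<Sum>l\<in>I. if l = j then A l u else 0)"
      using A by (intro sum.cong) (auto simp: linear_0)
    also have "\<dots> = z" using ju \<open>finite I\<close> by simp
    finally show "z \<in> ?E" using E[of "\<lambda>l. if l = j then u else 0" "\<lambda>_. 0"] by (simp only:)
  qed
  show "subspace ?E"
  proof (rule subspaceI)
    have "0 = (\<Sum>j\<in>I. A j 0 + smul i (A j 0))" using A by (simp add: linear_0)
    then show "0 \<in> ?E" using E[of "\<lambda>_. 0" "\<lambda>_. 0"] by (simp only:)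
  next
    fix z w assume "z \<in> ?E" "w \<in> ?E"
    then obtain x y x' y' where zw: "z = (\<Sum>j\<in>I. A j (x j) + smul i (A j (y j)))"
      "w = (\<Sum>j\<in>I. A j (x' j) + smul i (A j (y' j)))" by blast
    have "z + w = (\<Sum>j\<in>I. A j (x j + x' j) + smul i (A j (y j + y' j)))"
      unfolding zw sum.distrib[symmetric]
      using A by (intro sum.cong) (simp_all add: linear_add smul.add)
    then show "z + w \<in> ?E" 
      using E[of "\<lambda>j. x j + x' j" "\<lambda>j. y j + y' j"] by (simp only:)
  next
    fix c z assume "z \<in> ?E"
    then obtain x y where z: "z = (\<Sum>j\<in>I. A j (x j) + smul i (A j (y j)))" by blast
    obtain a b where ab: "c = of_real a + of_real b * i" using i by blast
    obtain a' b' where ab': "c * i = of_real a' + of_real b' * i" using i by blast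
    have c: "smul c u = a *\<^sub>R u + b *\<^sub>R smul i u" for u
      by (simp add: ab scale_left_distrib scale_of_real[symmetric])
    have ci: "smul c (smul i u) = a' *\<^sub>R u + b' *\<^sub>R smul i u" for u
      by (simp add: ab' scale_left_distrib scale_of_real[symmetric])
    let ?x = "\<lambda>j. a *\<^sub>R x j + a' *\<^sub>R y j" and ?y = "\<lambda>j. b *\<^sub>R x j + b' *\<^sub>R y j"
    have "smul c z = (\<Sum>j\<in>I. A j (?x j) + smul i (A j (?y j)))"
      unfolding z scale_sum_right
    proof (rule sum.cong)
      fix j
      show "smul c (A j (x j) + smul i (A j (y j))) = A j (?x j) + smul i (A j (?y j))"
        using A by (simp only: scale_right_distrib c[of "A j (x j)"] ci[of "A j (y j)"]
            linear_add linear_scale smul.add smul.scaleR)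
          (simp add: algebra_simps)
    qed simp
    then show "smul c z \<in> ?E" using E[of ?x ?y] by (simp only:)
  qed
qed

lemma span_UN_eq_UN_span_atMost:
  fixes B :: "nat \<Rightarrow> 'h set"
  shows "span (\<Union>j. B j) = (\<Union>m. span (\<Union>j\<le>m. B j))"
proof
  show "span (\<Union>j. B j) \<subseteq> (\<Union>m. span (\<Union>j\<le>m. B j))"
  proof
    fix v assume "v \<in> span (\<Union>j. B j)"
    then obtain t r where t: "finite t" "t \<subseteq> (\<Union>j. B j)" and v: "v = (\<Sum>a\<in>t. smul (r a) a)"
      unfolding span_explicit by blast
    have "\<forall>a\<in>t. \<exists>j. a \<in> B j" using t(2) by blast
    then obtain f where f: "\<And>a. a \<in> t \<Longrightarrow> a \<in> B (f a)" by metis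
    have "t \<subseteq> (\<Union>j\<le>Max (f ` t). B j)" using t(1) f by fastforce
    then have "v \<in> span (\<Union>j\<le>Max (f ` t). B j)"
      unfolding v by (intro span_sum span_scale span_base) blast
    then show "v \<in> (\<Union>m. span (\<Union>j\<le>m. B j))" by blast
  qed
  show "(\<Union>m. span (\<Union>j\<le>m. B j)) \<subseteq> span (\<Union>j. B j)"
    by (intro UN_least span_mono) blast
qed

text \<open>
  The map \<open>T\<^sub>j(x, y) = A\<^sub>j x + i A\<^sub>j y\<close> on the Banach space \<open>\<H> \<times> \<H>\<close> is bounded and real-linear, and its
  range is the span of the range of \<open>A\<^sub>j\<close>.
\<close>

lemma span_ranges_eq_UNIV_imp_finite:
  fixes A :: "nat \<Rightarrow> 'h \<Rightarrow> 'h"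
  assumes A: "\<And>j. bounded_linear (A j)"
    and all: "span (\<Union>j. range (A j)) = UNIV"
  shows "\<exists>m. span (\<Union>j\<le>m. range (A j)) = UNIV"
proof -
  obtain i :: 'k where i: "\<And>c. \<exists>a b. c = of_real a + of_real b * i"
    using conj_scalar_generated_by_one_element by blast
  define T where "T j p = A j (fst p) + smul i (A j (snd p))" for j p
  have T: "bounded_linear (T j)" for j
    unfolding T_def
    by (intro bounded_linear_add bounded_linear_compose[OF A] bounded_linear_fst bounded_linear_snd
        bounded_linear_compose[OF bounded_linear_smul])
  have "\<exists>m p. z = (\<Sum>j\<le>m. T j (p j))" for z
  proof -
    have "z \<in> (\<Union>m. span (\<Union>j\<le>m. range (A j)))"
      using all by (simp only: span_UN_eq_UN_span_atMost) simp
    then obtain m where "z \<in> span (\<Union>j\<le>m. range (A j))" by blast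
    then obtain x y where "z = (\<Sum>j\<le>m. A j (x j) + smul i (A j (y j)))"
      using span_ranges_subset[of i A "{..m}", OF i bounded_linear.linear[OF A] finite_atMost]
      by blast
    then have "z = (\<Sum>j\<le>m. T j (x j, y j))" by (simp add: T_def)
    then show ?thesis by (intro exI[of _ m] exI[of _ "\<lambda>j. (x j, y j)"])
  qed
  with T obtain m where m: "\<And>z. \<exists>p. z = (\<Sum>j\<le>m. T j (p j))"
    using finitely_many_ranges_suffice by metis
  have "z \<in> span (\<Union>j\<le>m. range (A j))" for z
  proof -
    obtain p where "z = (\<Sum>j\<le>m. T j (p j))" using m by blast
    then show ?thesis
      unfolding T_def by (auto intro!: span_sum span_add span_scale intro: span_base)
  qed
  then show ?thesis by blast
qed

end

theorem proposition3p3: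
  fixes smul :: "'k::conj_scalar \<Rightarrow> 'h::banach \<Rightarrow> 'h"
    and ip :: "'h \<Rightarrow> 'h \<Rightarrow> 'k"
    and J R :: "'h \<Rightarrow>\<^sub>L 'h"
  assumes "hilbert_space smul ip"
    and "separable_space (euclidean :: 'h topology)"
    and "J \<in> bounded_operators smul" and "skew_adjoint ip J"
    and "R \<in> bounded_operators smul" and "self_adjoint ip R" and "nonneg_op ip R"
    and "module.span smul
           (\<Union>j. range ((blinfun_apply J ^^ j) \<circ> blinfun_apply (op_sqrt smul ip R))) = UNIV"
  shows "\<exists>m::nat. module.span smul
           (\<Union>j\<le>m. range ((blinfun_apply J ^^ j) \<circ> blinfun_apply (op_sqrt smul ip R))) = UNIV"
proof -
  interpret hilbert_space smul ip by fact
  have "bounded_linear (blinfun_apply J ^^ j)" for j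
  proof (induction j)
    case 0
    show ?case by (simp add: id_def)
  next
    case (Suc j)
    then show ?case
      by (simp add: o_def bounded_linear_compose[OF blinfun.bounded_linear_right])
  qed
  then have "bounded_linear ((blinfun_apply J ^^ j) \<circ> blinfun_apply (op_sqrt smul ip R))" for j
    unfolding o_def by (rule bounded_linear_compose) (rule blinfun.bounded_linear_right)
  then show ?thesis using assms(8) by (rule span_ranges_eq_UNIV_imp_finite)
qed

end
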